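(* Let $a,b,c,d,e,f$ be independent variables over $\mathbf{Q}$ and let $\mathcal{E}=\mathbf{Q}(a,b,c,d,e,f)$. In the projective plane $\mathbf{P}^2$ over $\mathcal{E}$ consider the six points $A=[1,a,a^2]$, $B=[1,b,b^2]$, $C=[1,c,c^2]$, $D=[1,d,d^2]$, $E=[1,e,e^2]$, $F=[1,f,f^2]$ on the conic $z_1^2=z_0z_2$, and the four Pascal lines $$\ell_1=\left\{\begin{array}{ccc} A & D & B \\ E & C & F \end{array}\right\},\quad \ell_2=\left\{\begin{array}{ccc} A & C & F \\ E & D & B \end{array}\right\},\quad \ell_3=\left\{\begin{array}{ccc} A & D & F \\ E & C & B \end{array}\right\},\quad \ell_*=\left\{\begin{array}{ccc} A & B & C \\ F & D & E \end{array}\right\}.$$ Let $\langle 1,s_i,t_i\rangle$ be the line coordinates of $\ell_i$ for $i=1,2,3,*$, where $s_i,t_i\in\mathcal{E}$. Then each of the variables $a,b,c,d,e,f$ can be expressed as a rational function, with coefficients in $\mathbf{Q}$, of $s_1,t_1,s_2,t_2,s_3,t_3,s_*,t_*$; that is, $\mathbf{Q}(s_1,t_1,s_2,t_2,s_3,t_3,s_*,t_* )=\mathcal{E}$.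
   Context: $\mathbf{P}^2$ has homogeneous coordinates $[z_0,z_1,z_2]$. A line $u_0z_0+u_1z_1+u_2z_2=0$ has homogeneous line coordinates $\langle u_0,u_1,u_2\rangle$ (defined up to a nonzero common scalar). For six distinct points $P_1,P_2,P_3,R_1,R_2,R_3$ on a nonsingular conic, arranged in an array $\left[\begin{array}{ccc} P_1 & P_2 & P_3 \\ R_1 & R_2 & R_3 \end{array}\right]$, Pascal's theorem says that the three points $P_1R_2\cap P_2R_1$, $P_2R_3\cap P_3R_2$, $P_1R_3\cap P_3R_1$ are collinear (here $XY$ denotes the line joining $X$ and $Y$). The line containing them is called the Pascal line of the array and is denoted $\left\{\begin{array}{ccc} P_1 & P_2 & P_3 \\ R_1 & R_2 & R_3 \end{array}\right\}$. For each of the four Pascals above the first line coordinate is a nonzero element of $\mathcal{E}$, so the line coordinates can be normalized uniquely to the form $\langle 1,s_i,t_i\rangle$. *)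

theory Defs
  imports Complex_Main
    "HOL-Library.Poly_Mapping"
    "HOL-Library.Numeral_Type"
    "HOL-Computational_Algebra.Fraction_Field"
begin

section \<open>The field of rational functions in six independent variables\<close>

instance fract :: ("{idom, ring_char_0}") field_char_0
proof
  show "inj (of_nat :: nat \<Rightarrow> 'a fract)"
    by (rule injI) (simp add: of_nat_fract eq_fract)
qed

text \<open>
  The monomials in the variables indexed by the six-element type \<open>6\<close> are the maps \<open>6 \<Rightarrow>\<^sub>0 nat\<close>, so
  \<open>(6 \<Rightarrow>\<^sub>0 nat) \<Rightarrow>\<^sub>0 rat\<close> is the polynomial ring over the rationals in six variables.
\<close>

type_synonym ratfun6 = "((6 \<Rightarrow>\<^sub>0 nat) \<Rightarrow>\<^sub>0 rat) fract"

definition indet :: "6 \<Rightarrow> ratfun6" where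
  "indet i = Fract (Poly_Mapping.single (Poly_Mapping.single i 1) 1) 1"


section \<open>The projective plane over a field\<close>

text \<open>
  The point \<open>[z\<^sub>0, z\<^sub>1, z\<^sub>2]\<close> is the class of its homogeneous coordinate vectors.  It is a point of
  the plane only if the coordinates are not all zero.
\<close>

definition hpoint :: "'a::field \<Rightarrow> 'a \<Rightarrow> 'a \<Rightarrow> ('a \<times> 'a \<times> 'a) set" where
  "hpoint z0 z1 z2 = {(c * z0, c * z1, c * z2) | c. c \<noteq> 0}"

text \<open>
  The line with line coordinates \<open>\<langle>u\<^sub>0, u\<^sub>1, u\<^sub>2\<rangle>\<close>, as a set of points.
\<close>

definition hline :: "'a::field \<Rightarrow> 'a \<Rightarrow> 'a \<Rightarrow> ('a \<times> 'a \<times> 'a) set set" where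
  "hline u0 u1 u2 = {hpoint z0 z1 z2 | z0 z1 z2.
     (z0, z1, z2) \<noteq> (0, 0, 0) \<and> u0 * z0 + u1 * z1 + u2 * z2 = 0}"

definition proj_lines :: "('a::field \<times> 'a \<times> 'a) set set set" where
  "proj_lines = {hline u0 u1 u2 | u0 u1 u2. (u0, u1, u2) \<noteq> (0, 0, 0)}"

text \<open>
  The following three operations are meaningful only where the described object is unique: for
  distinct points, for distinct lines, and for arrays whose three intersection points are defined,
  collinear and not all equal.
\<close>

definition join :: "('a::field \<times> 'a \<times> 'a) set \<Rightarrow> ('a \<times> 'a \<times> 'a) set \<Rightarrow> ('a \<times> 'a \<times> 'a) set set" where
  "join X Y = (THE L. L \<in> proj_lines \<and> X \<in> L \<and> Y \<in> L)"

definition meet :: "('a::field \<times> 'a \<times> 'a) set set \<Rightarrow> ('a \<times> 'a \<times> 'a) set set \<Rightarrow> ('a \<times> 'a \<times> 'a) set" where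
  "meet L M = (THE X. X \<in> L \<and> X \<in> M)"

text \<open>
  The Pascal line of the array with rows \<open>P1 P2 P3\<close> and \<open>R1 R2 R3\<close>.
\<close>

definition pascal_line ::
  "('a::field \<times> 'a \<times> 'a) set \<Rightarrow> ('a \<times> 'a \<times> 'a) set \<Rightarrow> ('a \<times> 'a \<times> 'a) set \<Rightarrow>
   ('a \<times> 'a \<times> 'a) set \<Rightarrow> ('a \<times> 'a \<times> 'a) set \<Rightarrow> ('a \<times> 'a \<times> 'a) set \<Rightarrow>
   ('a \<times> 'a \<times> 'a) set set" where
  "pascal_line P1 P2 P3 R1 R2 R3 = (THE L. L \<in> proj_lines \<and>
     meet (join P1 R2) (join P2 R1) \<in> L \<and>
     meet (join P2 R3) (join P3 R2) \<in> L \<and>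
     meet (join P1 R3) (join P3 R1) \<in> L)"


section \<open>Rational expressions and generated subfields\<close>

text \<open>
  The value of a polynomial with rational coefficients when \<open>v i\<close> is substituted for the
  \<open>i\<close>-th variable.
\<close>

definition mpoly_eval :: "(nat \<Rightarrow> 'a::field_char_0) \<Rightarrow> ((nat \<Rightarrow>\<^sub>0 nat) \<Rightarrow>\<^sub>0 rat) \<Rightarrow> 'a" where
  "mpoly_eval v p = (\<Sum>m\<in>Poly_Mapping.keys p. of_rat (Poly_Mapping.lookup p m) *
     (\<Prod>i\<in>Poly_Mapping.keys m. v i ^ Poly_Mapping.lookup m i))"

definition mpoly_vars :: "((nat \<Rightarrow>\<^sub>0 nat) \<Rightarrow>\<^sub>0 rat) \<Rightarrow> nat set" where
  "mpoly_vars p = (\<Union>m\<in>Poly_Mapping.keys p. Poly_Mapping.keys m)"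

definition is_rational_function_of :: "'a::field_char_0 \<Rightarrow> 'a list \<Rightarrow> bool" where
  "is_rational_function_of x ys \<longleftrightarrow> (\<exists>p q.
     mpoly_vars p \<subseteq> {..<length ys} \<and> mpoly_vars q \<subseteq> {..<length ys} \<and>
     mpoly_eval (nth ys) q \<noteq> 0 \<and> x = mpoly_eval (nth ys) p / mpoly_eval (nth ys) q)"

definition is_subfield :: "'a::field set \<Rightarrow> bool" where
  "is_subfield K \<longleftrightarrow> 0 \<in> K \<and> 1 \<in> K \<and>
     (\<forall>x\<in>K. \<forall>y\<in>K. x + y \<in> K \<and> x * y \<in> K) \<and>
     (\<forall>x\<in>K. - x \<in> K \<and> inverse x \<in> K)"

text \<open>
  In characteristic 0 every subfield contains the rationals, so the subfield generated by \<open>S\<close>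
  is the extension of the rationals generated by \<open>S\<close>.
\<close>

definition rat_adjoin :: "'a::field_char_0 set \<Rightarrow> 'a set" where
  "rat_adjoin S = \<Inter>{K. is_subfield K \<and> S \<subseteq> K}"

end

(*
  The lines l1, l2, l3 form a triangle with vertices X = AC.DE, Y = BC.DF, Z = AB.EF.  So ABC and
  EFD are two triangles inscribed in the conic whose sides pass through X, Y, Z (Castillon's problem):
  a and e are the fixed points of the composition of the involutions with centres Z, Y, X.  Over the
  field K generated by the line coordinates they are therefore the roots of a quadratic polynomial,
  and b, c (resp. f, d) are images of a (resp. e) under these involutions.  If a were not in K, the
  conjugation of K(a) over K would exchange A, B, C with E, F, D and fix l*.  Then l* would contain
  both AD.BF and its conjugate EC.BF, besides BE.CD; but these three points are not collinear.
  Such inequalities are checked by specializing the indeterminates to rational numbers.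
*)

theory Submission
  imports Defs
begin

section \<open>Values of polynomials\<close>

text \<open>The type of variables stays arbitrary, since two instances occur: \<open>nat\<close> for
  the rational expressions in the statement and \<open>6\<close> for the indeterminates of
  \<open>ratfun6\<close>.\<close>

definition monom_value :: "('v \<Rightarrow> 'a::comm_semiring_1) \<Rightarrow> ('v \<Rightarrow>\<^sub>0 nat) \<Rightarrow> 'a" where
  "monom_value v m = (\<Prod>i\<in>Poly_Mapping.keys m. v i ^ Poly_Mapping.lookup m i)"

definition poly_value :: "('v \<Rightarrow> 'a::field_char_0) \<Rightarrow> (('v \<Rightarrow>\<^sub>0 nat) \<Rightarrow>\<^sub>0 rat) \<Rightarrow> 'a" where
  "poly_value v p = (\<Sum>m\<in>Poly_Mapping.keys p. of_rat (Poly_Mapping.lookup p m) * monom_value v m)"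

definition poly_vars :: "(('v \<Rightarrow>\<^sub>0 nat) \<Rightarrow>\<^sub>0 'b::zero) \<Rightarrow> 'v set" where
  "poly_vars p = (\<Union>m\<in>Poly_Mapping.keys p. Poly_Mapping.keys m)"

lemma mpoly_eval_eq: "mpoly_eval = poly_value"
  by (simp add: fun_eq_iff mpoly_eval_def poly_value_def monom_value_def)

lemma mpoly_vars_eq: "mpoly_vars = poly_vars"
  by (simp add: fun_eq_iff mpoly_vars_def poly_vars_def)

section \<open>Evaluation is a ring homomorphism\<close>

lemma monom_value_superset:
  assumes "finite S" "Poly_Mapping.keys m \<subseteq> S"
  shows "monom_value v m = (\<Prod>i\<in>S. v i ^ Poly_Mapping.lookup m i)"
  unfolding monom_value_def
  by (rule prod.mono_neutral_left[OF assms]) (auto simp: in_keys_iff)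

lemma monom_value_add: "monom_value v (m + n) = monom_value v m * monom_value v n"
proof -
  let ?S = "Poly_Mapping.keys m \<union> Poly_Mapping.keys n"
  show ?thesis
    using keys_add[of m n]
    by (simp add: monom_value_superset[of ?S] lookup_add power_add prod.distrib)
qed

lemma monom_value_0 [simp]: "monom_value v 0 = 1"
  by (simp add: monom_value_def)

lemma monom_value_single [simp]: "monom_value v (Poly_Mapping.single i k) = v i ^ k"
  by (cases "k = 0") (simp_all add: monom_value_def)

lemma poly_value_add: "poly_value v (p + q) = poly_value v p + poly_value v q"
  unfolding poly_value_def
  by (rule setsum_keys_plus_distrib) (simp_all add: of_rat_add distrib_right)

lemma poly_value_0 [simp]: "poly_value v 0 = 0"
  by (simp add: poly_value_def)

lemma poly_value_single [simp]:
  "poly_value v (Poly_Mapping.single m c) = of_rat c * monom_value v m"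
  by (cases "c = 0") (simp_all add: poly_value_def)

lemma poly_value_1 [simp]: "poly_value v 1 = 1"
  using poly_value_single[of v 0 1] by simp

lemma poly_value_sum: "poly_value v (sum g S) = (\<Sum>i\<in>S. poly_value v (g i))"
  by (induction S rule: infinite_finite_induct) (simp_all add: poly_value_add)

lemma poly_mapping_sum_singles:
  fixes p :: "'v \<Rightarrow>\<^sub>0 'b::comm_monoid_add"
  shows
  "(\<Sum>m\<in>Poly_Mapping.keys p. Poly_Mapping.single m (Poly_Mapping.lookup p m)) = p"
  by (rule poly_mapping_eqI)
    (auto simp: lookup_sum lookup_single when_def in_keys_iff sum.delta' intro: sum.neutral)

text \<open>Splitting both factors into single terms reduces multiplicativity to the case of two
  terms, where it is \<open>monom_value_add\<close>.\<close>

lemma poly_value_mult: "poly_value v (p * q) = poly_value v p * poly_value v q"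
proof -
  let ?P = "Poly_Mapping.keys p" and ?Q = "Poly_Mapping.keys q"
  let ?p = "\<lambda>m. Poly_Mapping.single m (Poly_Mapping.lookup p m)"
  let ?q = "\<lambda>m. Poly_Mapping.single m (Poly_Mapping.lookup q m)"
  have "p * q = (\<Sum>m\<in>?P. ?p m) * (\<Sum>n\<in>?Q. ?q n)"
    by (simp only: poly_mapping_sum_singles)
  also have "\<dots> = (\<Sum>m\<in>?P. \<Sum>n\<in>?Q. ?p m * ?q n)"
    by (rule sum_product)
  finally have "poly_value v (p * q) = (\<Sum>m\<in>?P. \<Sum>n\<in>?Q. poly_value v (?p m * ?q n))"
    by (simp add: poly_value_sum)
  also have "\<dots> = (\<Sum>m\<in>?P. \<Sum>n\<in>?Q. poly_value v (?p m) * poly_value v (?q n))"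
    by (simp add: mult_single of_rat_mult monom_value_add mult_ac)
  also have "\<dots> = poly_value v (\<Sum>m\<in>?P. ?p m) * poly_value v (\<Sum>n\<in>?Q. ?q n)"
    by (simp only: poly_value_sum sum_product)
  finally show ?thesis
    by (simp only: poly_mapping_sum_singles)
qed

lemma poly_value_uminus: "poly_value v (- p) = - poly_value v p"
  using poly_value_add[of v p "- p"] by (simp add: add_eq_0_iff)

section \<open>Variables of sums and products\<close>

lemma poly_vars_add: "poly_vars (p + q) \<subseteq> poly_vars p \<union> poly_vars q"
  unfolding poly_vars_def using keys_add[of p q] by blast

lemma poly_vars_mult: "poly_vars (p * q) \<subseteq> poly_vars p \<union> poly_vars q"
proof
  fix i assume "i \<in> poly_vars (p * q)"
  then obtain m where m: "m \<in> Poly_Mapping.keys (p * q)" "i \<in> Poly_Mapping.keys m"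
    unfolding poly_vars_def by blast
  then obtain k l where "m = k + l" "k \<in> Poly_Mapping.keys p" "l \<in> Poly_Mapping.keys q"
    using keys_mult[of p q] by blast
  then show "i \<in> poly_vars p \<union> poly_vars q"
    using m(2) keys_add[of k l] unfolding poly_vars_def by blast
qed

lemma poly_vars_uminus [simp]: "poly_vars (- p) = poly_vars (p :: ('v \<Rightarrow>\<^sub>0 nat) \<Rightarrow>\<^sub>0 rat)"
  by (simp add: poly_vars_def in_keys_iff set_eq_iff)

lemma poly_vars_0 [simp]: "poly_vars 0 = {}"
  by (simp add: poly_vars_def)

lemma poly_vars_1 [simp]: "poly_vars 1 = {}"
  by (simp add: poly_vars_def)

lemma poly_vars_single: "poly_vars (Poly_Mapping.single m c) \<subseteq> Poly_Mapping.keys m"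
  by (simp add: poly_vars_def)


section \<open>Subfields\<close>

lemma is_rational_function_of_subfield: "is_subfield {x. is_rational_function_of x ys}"
proof -
  let ?V = "poly_value (nth ys)"
  have ratI: "is_rational_function_of x ys"
    if "poly_vars p \<subseteq> {..<length ys}" "poly_vars q \<subseteq> {..<length ys}"
      "?V q \<noteq> 0" "x = ?V p / ?V q" for x p q
    using that unfolding is_rational_function_of_def mpoly_eval_eq mpoly_vars_eq by blast
  have "is_rational_function_of 0 ys" "is_rational_function_of 1 ys"
    by (rule ratI[of 0 1] ratI[of 1 1]; simp)+
  moreover have "is_rational_function_of (x + y) ys \<and> is_rational_function_of (x * y) ys"
    if "is_rational_function_of x ys" "is_rational_function_of y ys" for x y
  proof -
    obtain p q where x: "poly_vars p \<subseteq> {..<length ys}" "poly_vars q \<subseteq> {..<length ys}"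
        "?V q \<noteq> 0" "x = ?V p / ?V q"
      using \<open>is_rational_function_of x ys\<close>
      unfolding is_rational_function_of_def mpoly_eval_eq mpoly_vars_eq by blast
    obtain p' q' where y: "poly_vars p' \<subseteq> {..<length ys}" "poly_vars q' \<subseteq> {..<length ys}"
        "?V q' \<noteq> 0" "y = ?V p' / ?V q'"
      using \<open>is_rational_function_of y ys\<close>
      unfolding is_rational_function_of_def mpoly_eval_eq mpoly_vars_eq by blast
    have vars: "poly_vars (q * q') \<subseteq> {..<length ys}" "poly_vars (p * p') \<subseteq> {..<length ys}"
      "poly_vars (p * q' + p' * q) \<subseteq> {..<length ys}"
      using poly_vars_mult[of q q'] poly_vars_mult[of p p'] poly_vars_mult[of p q']
        poly_vars_mult[of p' q] poly_vars_add[of "p * q'" "p' * q"] x(1,2) y(1,2)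
      by blast+
    show ?thesis
    proof
      show "is_rational_function_of (x + y) ys"
        by (rule ratI[OF vars(3,1)])
          (use x(3,4) y(3,4) in \<open>simp_all add: poly_value_add poly_value_mult add_frac_eq mult.commute\<close>)
      show "is_rational_function_of (x * y) ys"
        by (rule ratI[OF vars(2,1)]) (use x(3,4) y(3,4) in \<open>simp_all add: poly_value_mult\<close>)
    qed
  qed
  moreover have "is_rational_function_of (- x) ys \<and> is_rational_function_of (inverse x) ys"
    if x_rat: "is_rational_function_of x ys" for x
  proof -
    obtain p q where x: "poly_vars p \<subseteq> {..<length ys}" "poly_vars q \<subseteq> {..<length ys}"
        "?V q \<noteq> 0" "x = ?V p / ?V q"
      using x_rat unfolding is_rational_function_of_def mpoly_eval_eq mpoly_vars_eq by blast
    have "is_rational_function_of (- x) ys"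
      by (rule ratI[of "- p" q]) (use x in \<open>simp_all add: poly_value_uminus\<close>)
    moreover have "is_rational_function_of (inverse x) ys"
    \<comment> \<open>Exchanging numerator and denominator fails for \<open>x = 0\<close>, whose
      inverse is \<open>0\<close> by convention.\<close>
    proof (cases "?V p = 0")
      case True
      then show ?thesis
        using \<open>is_rational_function_of 0 ys\<close> x(4) by simp
    next
      case False
      then show ?thesis
        by (intro ratI[of q p]) (use x in simp_all)
    qed
    ultimately show ?thesis ..
  qed
  ultimately show ?thesis
    unfolding is_subfield_def by blast
qed

lemma is_rational_function_of_member:
  assumes "y \<in> set ys"
  shows "is_rational_function_of y ys"
proof -
  obtain i where i: "i < length ys" "y = ys ! i"
    using assms by (metis in_set_conv_nth)
  let ?p = "Poly_Mapping.single (Poly_Mapping.single i 1) 1 :: (nat \<Rightarrow>\<^sub>0 nat) \<Rightarrow>\<^sub>0 rat"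
  have "poly_vars ?p \<subseteq> {..<length ys}"
    using poly_vars_single[of "Poly_Mapping.single i 1" "1 :: rat"] i(1) by auto
  moreover have "poly_value (nth ys) ?p = y"
    using i(2) by simp
  ultimately show ?thesis
    unfolding is_rational_function_of_def mpoly_eval_eq mpoly_vars_eq
    by (intro exI[of _ ?p] exI[of _ 1]) simp
qed

section \<open>Closure properties of subfields\<close>

context
  fixes K :: "'a::field set"
  assumes K: "is_subfield K"
begin

lemma subfield_0: "0 \<in> K" and subfield_1: "1 \<in> K"
  using K by (simp_all add: is_subfield_def)

lemma subfield_add: "x \<in> K \<Longrightarrow> y \<in> K \<Longrightarrow> x + y \<in> K"
  and subfield_mult: "x \<in> K \<Longrightarrow> y \<in> K \<Longrightarrow> x * y \<in> K"
  and subfield_uminus: "x \<in> K \<Longrightarrow> - x \<in> K"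
  and subfield_inverse: "x \<in> K \<Longrightarrow> inverse x \<in> K"
  using K by (simp_all add: is_subfield_def)

lemma subfield_diff: "x \<in> K \<Longrightarrow> y \<in> K \<Longrightarrow> x - y \<in> K"
  using subfield_add[OF _ subfield_uminus] by fastforce

lemma subfield_divide: "x \<in> K \<Longrightarrow> y \<in> K \<Longrightarrow> x / y \<in> K"
  by (simp add: divide_inverse subfield_mult subfield_inverse)

lemma subfield_power: "x \<in> K \<Longrightarrow> x ^ n \<in> K"
  by (induction n) (simp_all add: subfield_1 subfield_mult)

lemma subfield_prod: "(\<And>i. i \<in> S \<Longrightarrow> g i \<in> K) \<Longrightarrow> prod g S \<in> K"
  by (induction S rule: infinite_finite_induct) (simp_all add: subfield_1 subfield_mult)

lemma subfield_sum: "(\<And>i. i \<in> S \<Longrightarrow> g i \<in> K) \<Longrightarrow> sum g S \<in> K"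
  by (induction S rule: infinite_finite_induct) (simp_all add: subfield_0 subfield_add)

lemma subfield_of_nat: "of_nat n \<in> K"
  by (induction n) (simp_all add: subfield_0 subfield_1 subfield_add)

lemma subfield_of_int: "of_int n \<in> K"
  by (cases n) (simp_all del: of_nat_Suc add: subfield_of_nat subfield_uminus)

lemmas subfield_closed = subfield_0 subfield_1 subfield_add subfield_mult subfield_uminus
  subfield_inverse subfield_diff subfield_divide

end

lemma subfield_of_rat: "is_subfield K \<Longrightarrow> of_rat r \<in> (K :: 'a::field_char_0 set)"
  by (cases r) (simp add: of_rat_rat subfield_divide subfield_of_int)

lemma subfield_poly_value:
  assumes "is_subfield K" "\<And>i. v i \<in> K"
  shows "poly_value v p \<in> K"
  unfolding poly_value_def monom_value_def
  by (intro subfield_sum subfield_mult subfield_prod subfield_power subfield_of_rat assms)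


section \<open>Indeterminates and specialization\<close>

lemma Fract_of_int: "Fract (of_int k) 1 = (of_int k :: 'a::{idom, ring_char_0} fract)"
  by (cases k) (simp_all del: of_nat_Suc add: Fract_of_nat_eq flip: minus_fract)

lemma Fract_const: "Fract (Poly_Mapping.single 0 r) 1 = (of_rat r :: ratfun6)"
proof (cases r)
  case (Fract k l)
  \<comment> \<open>Multiplying by the denominator \<open>l\<close> reduces the claim to the integer
    constant \<open>k\<close>.\<close>
  have "Fract (Poly_Mapping.single 0 r) 1 * (of_int l :: ratfun6) =
      Fract (Poly_Mapping.single 0 r * Poly_Mapping.single 0 (of_int l)) 1"
    by (simp flip: Fract_of_int)
  also have "\<dots> = Fract (Poly_Mapping.single 0 (of_int k)) 1"
    using Fract by (simp add: mult_single Fract_of_int_quotient del: single_of_int)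
  also have "\<dots> = of_int k"
    by (simp add: Fract_of_int)
  finally show ?thesis
    using Fract by (simp add: of_rat_rat field_simps)
qed

lemma Fract_sum: "Fract (sum g S) (1 :: 'a::idom) = (\<Sum>i\<in>S. Fract (g i) 1)"
proof (induction S rule: infinite_finite_induct)
  case (insert i S)
  have "Fract (sum g (insert i S)) 1 = Fract (g i) 1 + Fract (sum g S) 1"
    using insert.hyps by simp
  then show ?case
    using insert by simp
qed (simp_all flip: Zero_fract_def)

text \<open>Monomials multiply by adding exponents, so writing \<open>m\<close> as a sum of singles
  factors it into powers of indeterminates.\<close>

lemma Fract_monom: "Fract (Poly_Mapping.single m 1) 1 = monom_value indet m"
proof -
  let ?F = "\<lambda>m. Fract (Poly_Mapping.single m 1) 1 :: ratfun6"
  have F0: "?F 0 = 1"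
    by (simp flip: One_fract_def)
  have F_add: "?F (m + n) = ?F m * ?F n" for m n
    by (simp add: mult_single)
  have F_single: "?F (Poly_Mapping.single i k) = indet i ^ k" for i k
  proof (induction k)
    case (Suc k)
    have "Poly_Mapping.single i (Suc k) = Poly_Mapping.single i 1 + Poly_Mapping.single i k"
      by (simp flip: single_add)
    then show ?case
      by (simp add: F_add Suc indet_def del: mult_fract)
  qed (simp flip: One_fract_def)
  have F_sum: "?F (sum g S) = (\<Prod>i\<in>S. ?F (g i))" for g and S :: "6 set"
    by (induction S rule: infinite_finite_induct) (simp_all add: F_add del: mult_fract flip: One_fract_def)
  have "?F m = ?F (\<Sum>i\<in>Poly_Mapping.keys m. Poly_Mapping.single i (Poly_Mapping.lookup m i))"
    by (simp only: poly_mapping_sum_singles)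
  then show ?thesis
    by (simp only: F_sum F_single monom_value_def)
qed

lemma Fract_eq_poly_value: "Fract p 1 = poly_value indet p"
proof -
  have "Fract p 1 = (\<Sum>m\<in>Poly_Mapping.keys p. 
      Fract (Poly_Mapping.single m (Poly_Mapping.lookup p m)) 1)"
    by (simp only: poly_mapping_sum_singles flip: Fract_sum)
  also have "\<dots> = poly_value indet p"
    unfolding poly_value_def
  proof (rule sum.cong[OF refl])
    fix m
    show "Fract (Poly_Mapping.single m (Poly_Mapping.lookup p m)) 1 =
        of_rat (Poly_Mapping.lookup p m) * monom_value indet m"
      by (simp add: mult_single flip: Fract_const Fract_monom)
  qed
  finally show ?thesis .
qed

text \<open>Every element of \<open>ratfun6\<close> is a quotient of two polynomials, each of which
  is its own value at the indeterminates.\<close>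

lemma subfield_generated_by_indets:
  assumes "is_subfield K" "\<And>i. indet i \<in> K"
  shows "K = UNIV"
proof -
  have "x \<in> K" for x
  proof (cases x)
    case (Fract p q)
    then have "x = Fract p 1 / Fract q 1"
      by simp
    then show ?thesis
      using assms by (simp only: Fract_eq_poly_value subfield_divide subfield_poly_value)
  qed
  then show ?thesis
    by blast
qed

text \<open>Evaluation at a rational point as a relation, restricted to elements with denominator 1
  so that no denominator can vanish at \<open>v\<close>. It serves to prove that polynomial
  expressions are nonzero.\<close>

definition specializes :: "(6 \<Rightarrow> rat) \<Rightarrow> ratfun6 \<Rightarrow> rat \<Rightarrow> bool" where
  "specializes v x r \<longleftrightarrow> (\<exists>p. x = Fract p 1 \<and> poly_value v p = r)"

lemma specializes_indet: "specializes v (indet i) (v i)"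
  unfolding specializes_def indet_def
  by (intro exI[of _ "Poly_Mapping.single (Poly_Mapping.single i 1) 1"]) simp

lemma specializes_1: "specializes v 1 1"
  unfolding specializes_def by (intro exI[of _ 1]) (simp add: One_fract_def)

lemma specializes_add: "specializes v x r \<Longrightarrow> specializes v y s \<Longrightarrow> specializes v (x + y) (r + s)"
  and specializes_mult: "specializes v x r \<Longrightarrow> specializes v y s \<Longrightarrow> specializes v (x * y) (r * s)"
  and specializes_uminus: "specializes v x r \<Longrightarrow> specializes v (- x) (- r)"
proof -
  assume "specializes v x r"
  then obtain p where p: "x = Fract p 1" "poly_value v p = r"
    unfolding specializes_def by blast
  then have "- x = Fract (- p) 1" "poly_value v (- p) = - r"
    by (simp_all add: poly_value_uminus)
  then show "specializes v (- x) (- r)"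
    unfolding specializes_def by blast
  assume "specializes v y s"
  then obtain q where q: "y = Fract q 1" "poly_value v q = s"
    unfolding specializes_def by blast
  have "x + y = Fract (p + q) 1" "poly_value v (p + q) = r + s"
    "x * y = Fract (p * q) 1" "poly_value v (p * q) = r * s"
    using p q by (simp_all add: poly_value_add poly_value_mult)
  then show "specializes v (x + y) (r + s)" "specializes v (x * y) (r * s)"
    unfolding specializes_def by blast+
qed

lemma specializes_diff:
  "specializes v x r \<Longrightarrow> specializes v y s \<Longrightarrow> specializes v (x - y) (r - s)"
  using specializes_add[OF _ specializes_uminus] by fastforce

lemma specializes_nonzero:
  assumes "specializes v x r" "r \<noteq> 0"
  shows "x \<noteq> 0"
proof
  assume "x = 0"
  with assms obtain p where "Fract p 1 = (0 :: ratfun6)" "poly_value v p \<noteq> 0"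
    unfolding specializes_def by auto
  then show False
    by (simp add: Zero_fract_def eq_fract)
qed

lemma cases_6: "(i::6) = 0 \<or> i = 1 \<or> i = 2 \<or> i = 3 \<or> i = 4 \<or> i = 5"
proof (cases i rule: bit0_cases)
  case (of_int z)
  then have "z = 0 \<or> z = 1 \<or> z = 2 \<or> z = 3 \<or> z = 4 \<or> z = 5"
    by auto
  with of_int show ?thesis
    by auto
qed


section \<open>Lines and points of the projective plane\<close>

fun dot :: "'a::field \<times> 'a \<times> 'a \<Rightarrow> 'a \<times> 'a \<times> 'a \<Rightarrow> 'a" where
  "dot (u0, u1, u2) (w0, w1, w2) = u0 * w0 + u1 * w1 + u2 * w2"

fun cross :: "'a::field \<times> 'a \<times> 'a \<Rightarrow> 'a \<times> 'a \<times> 'a \<Rightarrow> 'a \<times> 'a \<times> 'a" where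
  "cross (u0, u1, u2) (w0, w1, w2) = (u1 * w2 - u2 * w1, u2 * w0 - u0 * w2, u0 * w1 - u1 * w0)"

fun scale :: "'a::field \<Rightarrow> 'a \<times> 'a \<times> 'a \<Rightarrow> 'a \<times> 'a \<times> 'a" where
  "scale k (u0, u1, u2) = (k * u0, k * u1, k * u2)"

fun hpt :: "'a::field \<times> 'a \<times> 'a \<Rightarrow> ('a \<times> 'a \<times> 'a) set" where
  "hpt (z0, z1, z2) = hpoint z0 z1 z2"

fun hln :: "'a::field \<times> 'a \<times> 'a \<Rightarrow> ('a \<times> 'a \<times> 'a) set set" where
  "hln (u0, u1, u2) = hline u0 u1 u2"

definition zvec :: "'a::field \<times> 'a \<times> 'a" where "zvec = (0, 0, 0)"

lemma dot_commute: "dot u w = dot w u"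
  by (cases u; cases w) (simp add: mult.commute)

lemma dot_scale: "dot (scale k u) w = k * dot u w"
  by (cases u; cases w) (simp add: algebra_simps)

lemma dot_cross_left: "dot u (cross u w) = 0" and dot_cross_right: "dot w (cross u w) = 0"
  by (cases u; cases w; simp add: algebra_simps)+

lemma scale_1: "scale 1 u = u"
  by (cases u) simp

lemma scale_scale: "scale k (scale l u) = scale (k * l) u"
  by (cases u) (simp add: mult.assoc)

lemma scale_eq_zvec: "scale k u = zvec \<longleftrightarrow> k = 0 \<or> u = zvec"
  by (cases u) (auto simp: zvec_def)

text \<open>The two orthogonality equations make all 2x2 minors of \<open>u\<close> and
  \<open>cross x y\<close> vanish, so the vectors are proportional; the factor is read off at a
  nonzero coordinate of \<open>cross x y\<close>.\<close>

lemma orthogonal_cross: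
  assumes "dot u x = 0" "dot u y = 0" "cross x y \<noteq> zvec"
  obtains k where "u = scale k (cross x y)"
proof -
  obtain x0 x1 x2 y0 y1 y2 u0 u1 u2
    where x: "x = (x0, x1, x2)" and y: "y = (y0, y1, y2)" and u: "u = (u0, u1, u2)"
    by (cases x; cases y; cases u) blast
  define c0 c1 c2 where c: "c0 = x1 * y2 - x2 * y1" "c1 = x2 * y0 - x0 * y2" "c2 = x0 * y1 - x1 * y0"
  have eq: "u0 * x0 + u1 * x1 + u2 * x2 = 0" "u0 * y0 + u1 * y1 + u2 * y2 = 0"
    using assms(1,2) by (simp_all add: x y u)
  have p: "u0 * c1 = u1 * c0" "u1 * c2 = u2 * c1" "u0 * c2 = u2 * c0"
    unfolding c using eq by algebra+
  have cr: "cross x y = (c0, c1, c2)"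
    by (simp add: x y c)
  consider "c0 \<noteq> 0" | "c1 \<noteq> 0" | "c2 \<noteq> 0"
    using assms(3) cr by (auto simp: zvec_def)
  then show thesis
  proof cases
    case 1
    show thesis
      by (rule that[of "u0 / c0"]) (use 1 p in \<open>simp add: cr u field_simps\<close>)
  next
    case 2
    show thesis
      by (rule that[of "u1 / c1"]) (use 2 p in \<open>simp add: cr u field_simps\<close>)
  next
    case 3
    show thesis
      by (rule that[of "u2 / c2"]) (use 3 p in \<open>simp add: cr u field_simps\<close>)
  qed
qed

lemma hpt_eq: "hpt x = {scale k x | k. k \<noteq> 0}"
  by (cases x) (simp add: hpoint_def)

lemma hpt_scale:
  assumes "k \<noteq> 0"
  shows "hpt (scale k x) = hpt x"
proof -
  have "scale l x \<in> hpt (scale k x)" if "l \<noteq> 0" for l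
    using assms that unfolding hpt_eq
    by (auto simp: scale_scale intro!: exI[of _ "l / k"])
  moreover have "hpt (scale k x) \<subseteq> hpt x"
    using assms unfolding hpt_eq by (auto simp: scale_scale)
  ultimately show ?thesis
    unfolding hpt_eq by blast
qed

lemma hpt_eq_imp_scale: "hpt x = hpt y \<Longrightarrow> \<exists>k. x = scale k y"
proof -
  assume "hpt x = hpt y"
  moreover have "scale 1 x \<in> hpt x"
    unfolding hpt_eq by fastforce
  ultimately show ?thesis
    unfolding hpt_eq scale_1 by blast
qed

lemma hln_eq: "hln u = {hpt z | z. z \<noteq> zvec \<and> dot u z = 0}"
  by (cases u) (force simp: hline_def zvec_def)

lemma hln_scale: "k \<noteq> 0 \<Longrightarrow> hln (scale k u) = hln u"
  by (simp add: hln_eq dot_scale)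

lemma hpt_in_hln:
  assumes "x \<noteq> zvec"
  shows "hpt x \<in> hln u \<longleftrightarrow> dot u x = 0"
proof
  assume "hpt x \<in> hln u"
  then obtain z where "hpt x = hpt z" "dot u z = 0"
    unfolding hln_eq by blast
  then show "dot u x = 0"
    using hpt_eq_imp_scale[of x z] dot_scale dot_commute by (metis mult_zero_right)
qed (use assms hln_eq in blast)

lemma proj_lines_eq: "proj_lines = {hln u | u. u \<noteq> zvec}"
  unfolding proj_lines_def zvec_def by force

text \<open>The predicate \<open>P\<close> is left open so that the definite descriptions in
  \<open>join\<close> and in \<open>pascal_line\<close> are both covered: incidence with two
  distinct points already determines the line.\<close>

lemma the_line_through:
  assumes "cross x y \<noteq> zvec" "\<And>L. P L \<Longrightarrow> L \<in> proj_lines \<and> hpt x \<in> L \<and> hpt y \<in> L"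
    "P (hln (cross x y))"
  shows "(THE L. P L) = hln (cross x y)"
proof (rule the_equality)
  have nz: "x \<noteq> zvec" "y \<noteq> zvec"
    using assms(1) by (cases x; cases y; auto simp: zvec_def)+
  fix L assume "P L"
  then have L: "L \<in> proj_lines" "hpt x \<in> L" "hpt y \<in> L"
    using assms(2) by blast+
  then obtain u where u: "L = hln u" "u \<noteq> zvec"
    unfolding proj_lines_eq by blast
  with L nz have "dot u x = 0" "dot u y = 0"
    by (simp_all add: hpt_in_hln)
  then obtain k where "u = scale k (cross x y)"
    using orthogonal_cross assms(1) by blast
  with u show "L = hln (cross x y)"
    by (simp add: scale_eq_zvec hln_scale)
qed (fact assms(3))

lemma hln_cross_in_proj_lines: "cross x y \<noteq> zvec \<Longrightarrow> hln (cross x y) \<in> proj_lines"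
  unfolding proj_lines_eq by blast

lemma cross_zvec [simp]: "cross zvec y = zvec" "cross x zvec = zvec"
  by (cases x; cases y; simp add: zvec_def)+

lemma join_hpt:
  assumes "cross x y \<noteq> zvec"
  shows "join (hpt x) (hpt y) = hln (cross x y)"
proof -
  have "x \<noteq> zvec" "y \<noteq> zvec"
    using assms by auto
  then show ?thesis
    unfolding join_def using assms
    by (intro the_line_through)
      (auto simp: hpt_in_hln hln_cross_in_proj_lines dot_commute[of "cross x y"]
        dot_cross_left dot_cross_right)
qed

lemma meet_hln:
  assumes "cross u w \<noteq> zvec"
  shows "meet (hln u) (hln w) = hpt (cross u w)"
  unfolding meet_def
proof (rule the_equality)
  show "hpt (cross u w) \<in> hln u \<and> hpt (cross u w) \<in> hln w"
    using assms by (simp add: hpt_in_hln dot_cross_left dot_cross_right)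
next
  fix X assume "X \<in> hln u \<and> X \<in> hln w"
  then obtain z where z: "X = hpt z" "z \<noteq> zvec" "dot u z = 0" "dot w z = 0"
    using hpt_in_hln unfolding hln_eq by blast
  then obtain k where "z = scale k (cross u w)"
    using orthogonal_cross[of z u w] assms by (metis dot_commute)
  with z show "X = hpt (cross u w)"
    by (simp add: scale_eq_zvec hpt_scale)
qed


section \<open>Pascal lines\<close>

text \<open>Pairing with \<open>(1, t, t^2)\<close> gives \<open>(t - x) * (t - y)\<close>, so this
  is the line through the conic points with parameters \<open>x\<close> and
  \<open>y\<close>.\<close>

definition chord :: "'a::field \<Rightarrow> 'a \<Rightarrow> 'a \<times> 'a \<times> 'a" where
  "chord x y = (x * y, - (x + y), 1)"

lemma join_conic:
  assumes "x \<noteq> y"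
  shows "join (hpoint 1 x (x^2)) (hpoint 1 y (y^2)) = hln (chord x y)"
proof -
  have *: "cross (1, x, x^2) (1, y, y^2) = scale (y - x) (chord x y)"
    by (simp add: chord_def algebra_simps power2_eq_square)
  then have "cross (1, x, x^2) (1, y, y^2) \<noteq> zvec"
    using assms by (simp add: scale_eq_zvec) (simp add: chord_def zvec_def)
  from join_hpt[OF this] show ?thesis
    using assms by (simp add: * hln_scale del: cross.simps)
qed

text \<open>With the sides written as \<open>chord\<close>, collinearity is the vanishing of a
  determinant, a polynomial identity in the six parameters.\<close>

lemma pascal_theorem:
  "dot (cross (cross (chord p1 r2) (chord p2 r1)) (cross (chord p2 r3) (chord p3 r2)))
     (cross (chord p1 r3) (chord p3 r1)) = 0"
  by (simp add: chord_def) algebra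

text \<open>Turns an equation between a Pascal line and \<open>hline 1 s t\<close> into linear
  equations for \<open>s\<close> and \<open>t\<close>. The first two intersection points determine
  the line, and Pascal's theorem puts the third on it.\<close>

lemma pascal_line_incidence:
  fixes p1 p2 p3 r1 r2 r3 :: "'a::field"
  defines "X \<equiv> cross (chord p1 r2) (chord p2 r1)"
    and "Y \<equiv> cross (chord p2 r3) (chord p3 r2)"
    and "Z \<equiv> cross (chord p1 r3) (chord p3 r1)"
  assumes distinct: "p1 \<noteq> r2" "p2 \<noteq> r1" "p2 \<noteq> r3" "p3 \<noteq> r2" "p1 \<noteq> r3" "p3 \<noteq> r1"
    and nz: "cross X Y \<noteq> zvec" "Z \<noteq> zvec"
    and line: "pascal_line (hpoint 1 p1 (p1^2)) (hpoint 1 p2 (p2^2)) (hpoint 1 p3 (p3^2))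
      (hpoint 1 r1 (r1^2)) (hpoint 1 r2 (r2^2)) (hpoint 1 r3 (r3^2)) = hline 1 s t"
  shows "dot (1, s, t) X = 0" "dot (1, s, t) Y = 0" "dot (1, s, t) Z = 0"
proof -
  have XY: "X \<noteq> zvec" "Y \<noteq> zvec"
    using nz(1) by auto
  have on: "dot (cross X Y) X = 0" "dot (cross X Y) Y = 0" "dot (cross X Y) Z = 0"
    using pascal_theorem
    by (metis dot_commute dot_cross_left, metis dot_commute dot_cross_right, simp only: X_def Y_def Z_def)
  have "pascal_line (hpoint 1 p1 (p1^2)) (hpoint 1 p2 (p2^2)) (hpoint 1 p3 (p3^2))
      (hpoint 1 r1 (r1^2)) (hpoint 1 r2 (r2^2)) (hpoint 1 r3 (r3^2)) = hln (cross X Y)"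
    unfolding pascal_line_def using XY nz
    by (intro the_line_through)
      (auto simp: join_conic distinct meet_hln hpt_in_hln hln_cross_in_proj_lines on
        simp flip: X_def Y_def Z_def)
  \<comment> \<open>Equality of the two lines as point sets suffices: incidence is transferred
    without comparing coordinate vectors.\<close>
  then have "hln (1, s, t) = hln (cross X Y)"
    using line by simp
  then show "dot (1, s, t) X = 0" "dot (1, s, t) Y = 0" "dot (1, s, t) Z = 0"
    using XY nz(2) on by (metis hpt_in_hln)+
qed


section \<open>Conjugation in a quadratic extension\<close>

locale quadratic_pair =
  fixes K :: "'a::field set" and a e :: 'a
  assumes K: "is_subfield K" and sum_in: "a + e \<in> K" and prod_in: "a * e \<in> K"
    and notin: "a \<notin> K"
begin

text \<open>
  \<open>conj x x'\<close> is the graph of the automorphism of the quadratic extension \<open>K(a)\<close> over \<open>K\<close> that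
  exchanges the roots \<open>a\<close> and \<open>e\<close>.
\<close>

definition conj :: "'a \<Rightarrow> 'a \<Rightarrow> bool" where
  "conj x x' \<longleftrightarrow> (\<exists>u\<in>K. \<exists>v\<in>K. x = u + v * a \<and> x' = u + v * e)"

lemmas K_closed = subfield_closed[OF K]

lemma conjI: "x = u + v * a \<Longrightarrow> x' = u + v * e \<Longrightarrow> u \<in> K \<Longrightarrow> v \<in> K \<Longrightarrow> conj x x'"
  unfolding conj_def by blast

lemma conjE:
  assumes "conj x x'"
  obtains u v where "u \<in> K" "v \<in> K" "x = u + v * a" "x' = u + v * e"
  using assms unfolding conj_def by blast

lemma conj_const: "x \<in> K \<Longrightarrow> conj x x"
  by (rule conjI[of _ x 0]) (simp_all add: K_closed)

lemma conj_root: "conj a e" and conj_root': "conj e a"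
proof -
  show "conj a e"
    by (rule conjI[of _ 0 1]) (simp_all add: K_closed)
  \<comment> \<open>Here \<open>e = (a + e) - a\<close>, with \<open>a + e\<close> in
    \<open>K\<close>.\<close>
  show "conj e a"
    by (rule conjI[of _ "a + e" "- 1"]) (simp_all add: K_closed sum_in)
qed

lemma conj_add: "conj x x' \<Longrightarrow> conj y y' \<Longrightarrow> conj (x + y) (x' + y')"
proof (elim conjE)
  fix u v w z
  assume K: "u \<in> K" "v \<in> K" "w \<in> K" "z \<in> K"
    and eq: "x = u + v * a" "x' = u + v * e" "y = w + z * a" "y' = w + z * e"
  show ?thesis
    by (rule conjI[of _ "u + w" "v + z"]) (simp_all add: K K_closed eq algebra_simps)
qed

lemma conj_mult: "conj x x' \<Longrightarrow> conj y y' \<Longrightarrow> conj (x * y) (x' * y')"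
proof (elim conjE)
  fix u v w z
  assume K: "u \<in> K" "v \<in> K" "w \<in> K" "z \<in> K"
    and eq: "x = u + v * a" "x' = u + v * e" "y = w + z * a" "y' = w + z * e"
  \<comment> \<open>Both \<open>a\<close> and \<open>e\<close> satisfy
    \<open>t^2 = (a + e) * t - a * e\<close>, which reduces the quadratic term of either
    product.\<close>
  show ?thesis
    by (rule conjI[of _ "u * w - v * z * (a * e)" "u * z + v * w + v * z * (a + e)"])
      (simp_all add: K K_closed sum_in prod_in, simp_all add: eq algebra_simps)
qed

lemma conj_uminus: "conj x x' \<Longrightarrow> conj (- x) (- x')"
  using conj_mult[OF conj_const[of "- 1"]] by (simp add: K_closed)

lemma conj_diff: "conj x x' \<Longrightarrow> conj y y' \<Longrightarrow> conj (x - y) (x' - y')"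
  using conj_add[OF _ conj_uminus] by fastforce

text \<open>Since \<open>a \<notin> K\<close>, the elements 1 and \<open>a\<close> are linearly
  independent over \<open>K\<close>, so both coefficients of \<open>x\<close> vanish.\<close>

lemma conj_eq_0:
  assumes "conj x x'" "x = 0"
  shows "x' = 0"
proof -
  obtain u v where uv: "u \<in> K" "v \<in> K" "x = u + v * a" "x' = u + v * e"
    using assms(1) by (rule conjE)
  have "v = 0"
  proof (rule ccontr)
    assume "v \<noteq> 0"
    then have "a = - u / v"
      using uv(3) assms(2) by (simp add: field_simps eq_neg_iff_add_eq_0)
    then show False
      using notin uv(1,2) by (simp add: K_closed)
  qed
  then show ?thesis
    using uv assms(2) by simp
qed

text \<open>The norm \<open>x * x'\<close> lies in \<open>K\<close>, and the inverse of
  \<open>x\<close> is \<open>x'\<close> divided by the norm.\<close>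

lemma conj_inverse:
  assumes "conj x x'" "x' \<noteq> 0"
  shows "conj (inverse x) (inverse x')"
proof -
  obtain u v where uv: "u \<in> K" "v \<in> K" "x = u + v * a" "x' = u + v * e"
    using assms(1) by (rule conjE)
  have "x \<noteq> 0"
    using conj_eq_0 assms by blast
  have "conj x' x"
    unfolding uv by (intro conj_add conj_mult conj_const conj_root' uv)
  have norm: "x * x' \<in> K"
  proof -
    have "x * x' = u * u + u * v * (a + e) + v * v * (a * e)"
      by (simp add: uv algebra_simps)
    then show ?thesis
      by (simp add: K_closed uv(1,2) sum_in prod_in del: distrib_left)
  qed
  have "conj (inverse (x * x') * x') (inverse (x * x') * x)"
    by (intro conj_mult conj_const \<open>conj x' x\<close> K_closed norm)
  moreover have "inverse (x * x') * x' = inverse x" "inverse (x * x') * x = inverse x'"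
    using \<open>x \<noteq> 0\<close> assms(2) by (simp_all add: field_simps)
  ultimately show ?thesis
    by (simp only:)
qed

lemma conj_divide: "conj x x' \<Longrightarrow> conj y y' \<Longrightarrow> y' \<noteq> 0 \<Longrightarrow> conj (x / y) (x' / y')"
  unfolding divide_inverse by (intro conj_mult conj_inverse)

end

section \<open>Two triangles inscribed in a conic\<close>

text \<open>If the denominator vanished, \<open>z\<close> would be the conic point with parameter
  \<open>x\<close>; the second chord meets the conic only at \<open>p\<close> and \<open>q\<close>.
  The formula for \<open>y\<close> is the involution with centre \<open>z\<close>.\<close>

lemma chord_partner:
  fixes z0 z1 z2 :: "'a::field"
  assumes "dot (chord x y) (z0, z1, z2) = 0" "dot (chord p q) (z0, z1, z2) = 0"
    and "x \<noteq> p" "x \<noteq> q" "(z0, z1, z2) \<noteq> zvec"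
  shows "x * z0 - z1 \<noteq> 0" "y = (x * z1 - z2) / (x * z0 - z1)"
proof -
  have 1: "y * (x * z0 - z1) = x * z1 - z2"
    using assms(1) by (simp add: chord_def algebra_simps)
  have 2: "p * q * z0 - (p + q) * z1 + z2 = 0"
    using assms(2) by (simp add: chord_def algebra_simps)
  show nz: "x * z0 - z1 \<noteq> 0"
  proof
    assume 0: "x * z0 - z1 = 0"
    then have z: "z1 = x * z0" "z2 = x * (x * z0)"
      using 1 by simp_all
    have "z0 * ((x - p) * (x - q)) = 0"
      using 2 unfolding z by (simp add: algebra_simps)
    then show False
      using assms(3-5) z by (simp add: zvec_def)
  qed
  show "y = (x * z1 - z2) / (x * z0 - z1)"
    using 1 nz by (simp add: eq_divide_eq)
qed

text \<open>
  If \<open>ac\<close>, \<open>bc\<close>, \<open>ab\<close> pass through \<open>x\<close>, \<open>y\<close>, \<open>z\<close>, then \<open>a\<close> is a fixed point of the composition of the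
  involutions of the conic with centres \<open>z\<close>, \<open>y\<close>, \<open>x\<close>.  The following are the coefficients of the
  fixed point equation.
\<close>

fun fix2 :: "'a::field \<times> 'a \<times> 'a \<Rightarrow> 'a \<times> 'a \<times> 'a \<Rightarrow> 'a \<times> 'a \<times> 'a \<Rightarrow> 'a" where
  "fix2 (x0, x1, x2) (y0, y1, y2) (z0, z1, z2) =
     x0 * (y1 * z1 - y2 * z0) - x1 * (y0 * z1 - y1 * z0)"

fun fix1 :: "'a::field \<times> 'a \<times> 'a \<Rightarrow> 'a \<times> 'a \<times> 'a \<Rightarrow> 'a \<times> 'a \<times> 'a \<Rightarrow> 'a" where
  "fix1 (x0, x1, x2) (y0, y1, y2) (z0, z1, z2) =
     x0 * (y1 * z2 - y2 * z1) + x1 * (2 * (y1 * z1) - y0 * z2 - y2 * z0) - x2 * (y0 * z1 - y1 * z0)"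

fun fix0 :: "'a::field \<times> 'a \<times> 'a \<Rightarrow> 'a \<times> 'a \<times> 'a \<Rightarrow> 'a \<times> 'a \<times> 'a \<Rightarrow> 'a" where
  "fix0 (x0, x1, x2) (y0, y1, y2) (z0, z1, z2) =
     x1 * (y2 * z1 - y1 * z2) + x2 * (y0 * z2 - y1 * z1)"

text \<open>Trilinearity carries nonvanishing of \<open>fix2\<close> over to proportional coordinate
  vectors.\<close>

lemma fix2_scale: "fix2 (scale k x) (scale l y) (scale m z) = k * l * m * fix2 x y z"
  by (cases x; cases y; cases z) (simp add: algebra_simps)

text \<open>Obtained by eliminating \<open>b\<close> and \<open>c\<close> from the three
  incidences.\<close>

lemma inscribed_triangle_fixed_point:
  assumes "dot (chord a c) x = 0" "dot (chord b c) y = 0" "dot (chord a b) z = 0"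
  shows "fix2 x y z * a\<^sup>2 = fix1 x y z * a + fix0 x y z"
proof -
  obtain x0 x1 x2 y0 y1 y2 z0 z1 z2
    where [simp]: "x = (x0, x1, x2)" "y = (y0, y1, y2)" "z = (z0, z1, z2)"
    by (cases x; cases y; cases z) blast
  show ?thesis
    using assms by (simp add: chord_def) algebra
qed

lemma chord_commute: "chord x y = chord y x"
  by (simp add: chord_def algebra_simps)

text \<open>A vector orthogonal to \<open>X\<close> and \<open>Y\<close> is a multiple of their
  cross product, and pairing it with \<open>Z\<close> gives the same multiple of the nonzero
  determinant.\<close>

lemma triangle_not_on_line:
  assumes "dot (cross X Y) Z \<noteq> 0" "dot l X = 0" "dot l Y = 0" "dot l Z = 0"
  shows "l = zvec"
proof -
  have "cross X Y \<noteq> zvec"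
    using assms(1) by (cases Z) (auto simp: zvec_def)
  then obtain k where k: "l = scale k (cross X Y)"
    using orthogonal_cross assms(2,3) by blast
  then have "k = 0"
    using assms(1,4) by (simp add: dot_scale)
  then show ?thesis
    by (simp add: k scale_eq_zvec)
qed

text \<open>Rescales a vertex to the cross product of two lines, whose coordinates lie in any
  subfield containing \<open>s, t, s', t'\<close>.\<close>

lemma point_on_two_lines:
  assumes "dot (1, s, t) X = 0" "dot (1, s', t') X = 0" "(s, t) \<noteq> (s', t')" "X \<noteq> zvec"
  obtains k where "k \<noteq> 0" "X = scale k (cross (1, s, t) (1, s', t'))"
proof -
  have "cross (1, s, t) (1, s', t') \<noteq> zvec"
    using assms(3) by (auto simp: zvec_def)
  then obtain k where k: "X = scale k (cross (1, s, t) (1, s', t'))"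
    using orthogonal_cross[of X "(1, s, t)" "(1, s', t')"] assms(1,2) by (auto simp: dot_commute)
  with assms(4) have "k \<noteq> 0"
    by (metis scale_eq_zvec)
  then show thesis
    using k by (rule that)
qed

text \<open>The algebraic core, over any field: incidences are linear equations, and what holds for
  generic points is assumed as inequalities.\<close>

lemma sextuple_in_subfield:
  fixes a b c d e f s1 t1 s2 t2 s3 t3 s4 t4 :: "'a::field" and K :: "'a set"
  defines "X \<equiv> cross (chord a c) (chord d e)"
    and "Y \<equiv> cross (chord d f) (chord b c)"
    and "Z \<equiv> cross (chord a b) (chord f e)"
    and "P \<equiv> cross (chord a d) (chord b f)"
    and "P' \<equiv> cross (chord e c) (chord f b)"
    and "Q \<equiv> cross (chord b e) (chord c d)"
  assumes K: "is_subfield K"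
    and in_K: "s1 \<in> K" "t1 \<in> K" "s2 \<in> K" "t2 \<in> K" "s3 \<in> K" "t3 \<in> K" "s4 \<in> K" "t4 \<in> K"
    and distinct: "a \<noteq> d" "a \<noteq> e" "a \<noteq> f" "e \<noteq> b" "e \<noteq> c"
    and XYZ: "dot (cross X Y) Z \<noteq> 0" and fix2: "fix2 X Y Z \<noteq> 0"
    and PPQ: "dot (cross P P') Q \<noteq> 0"
    and l1: "dot (1, s1, t1) X = 0" "dot (1, s1, t1) Y = 0"
    and l2: "dot (1, s2, t2) Y = 0" "dot (1, s2, t2) Z = 0"
    and l3: "dot (1, s3, t3) X = 0" "dot (1, s3, t3) Z = 0"
    and l4: "dot (1, s4, t4) P = 0" "dot (1, s4, t4) Q = 0"
  shows "{a, b, c, d, e, f} \<subseteq> K"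
proof -
  note K_closed = subfield_closed[OF K]
  have XYZ_nz: "X \<noteq> zvec" "Y \<noteq> zvec" "Z \<noteq> zvec"
    using fix2 by (cases X; cases Y; cases Z; auto simp: zvec_def)+
  have not_zvec: "(1, s, t) \<noteq> zvec" for s t :: 'a
    by (simp add: zvec_def)
  \<comment> \<open>If two of the three lines coincided, that line would contain all of
    \<open>X\<close>, \<open>Y\<close>, \<open>Z\<close>.\<close>
  have ne: "(s1, t1) \<noteq> (s3, t3)" "(s1, t1) \<noteq> (s2, t2)" "(s2, t2) \<noteq> (s3, t3)"
    using triangle_not_on_line[OF XYZ] l1 l2 l3 not_zvec by (metis prod.inject)+
  \<comment> \<open>Unlike \<open>X\<close>, \<open>Y\<close>, \<open>Z\<close>, these proportional
    vectors visibly have coordinates in \<open>K\<close>.\<close>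
  define x y z where xyz: "x = cross (1, s1, t1) (1, s3, t3)"
    "y = cross (1, s1, t1) (1, s2, t2)" "z = cross (1, s2, t2) (1, s3, t3)"
  obtain kx where kx: "kx \<noteq> 0" "X = scale kx x"
    unfolding xyz using point_on_two_lines[OF l1(1) l3(1) ne(1) XYZ_nz(1)] .
  obtain ky where ky: "ky \<noteq> 0" "Y = scale ky y"
    unfolding xyz using point_on_two_lines[OF l1(2) l2(1) ne(2) XYZ_nz(2)] .
  obtain kz where kz: "kz \<noteq> 0" "Z = scale kz z"
    unfolding xyz using point_on_two_lines[OF l2(2) l3(2) ne(3) XYZ_nz(3)] .
  have nz: "x \<noteq> zvec" "y \<noteq> zvec" "z \<noteq> zvec"
    using XYZ_nz kx ky kz by (simp_all add: scale_eq_zvec)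
  obtain x0 x1 x2 y0 y1 y2 z0 z1 z2
    where c: "x = (x0, x1, x2)" "y = (y0, y1, y2)" "z = (z0, z1, z2)"
    by (cases x; cases y; cases z) blast
  have c_in: "x0 \<in> K" "x1 \<in> K" "x2 \<in> K" "y0 \<in> K" "y1 \<in> K" "y2 \<in> K" "z0 \<in> K" "z1 \<in> K" "z2 \<in> K"
    using xyz c by (auto intro!: K_closed in_K)
  have on: "dot u w = 0" if "dot u (scale k w) = 0" "k \<noteq> 0" for u w :: "'a \<times> 'a \<times> 'a" and k
    using that by (simp add: dot_commute[of u] dot_scale)
  \<comment> \<open>Each centre lies on corresponding sides of the triangles \<open>a, b, c\<close>
    and \<open>e, f, d\<close>, so \<open>a\<close> and \<open>e\<close> satisfy the same quadratic
    equation.\<close>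
  have x_on: "dot (chord a c) x = 0" "dot (chord e d) x = 0"
    by (rule on[OF _ kx(1)], fold kx(2), unfold X_def,
        simp add: dot_cross_left dot_cross_right chord_commute[of e])+
  have y_on: "dot (chord b c) y = 0" "dot (chord f d) y = 0"
    by (rule on[OF _ ky(1)], fold ky(2), unfold Y_def,
        simp add: dot_cross_left dot_cross_right chord_commute[of f])+
  have z_on: "dot (chord a b) z = 0" "dot (chord e f) z = 0"
    by (rule on[OF _ kz(1)], fold kz(2), unfold Z_def,
        simp add: dot_cross_left dot_cross_right chord_commute[of e])+
  define q2 q1 q0 where q: "q2 = fix2 x y z" "q1 = fix1 x y z" "q0 = fix0 x y z"
  have "2 \<in> K"
    using K_closed(3)[OF K_closed(2,2)] by simp
  then have q_in: "q2 \<in> K" "q1 \<in> K" "q0 \<in> K"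
    unfolding q c by (auto intro!: K_closed c_in)
  have "q2 \<noteq> 0"
    using fix2 by (simp add: kx ky kz fix2_scale q)
  have fixed: "q2 * a\<^sup>2 = q1 * a + q0" "q2 * e\<^sup>2 = q1 * e + q0"
    unfolding q
    using inscribed_triangle_fixed_point[OF x_on(1) y_on(1) z_on(1)]
      inscribed_triangle_fixed_point[OF x_on(2) y_on(2) z_on(2)] by blast+
  \<comment> \<open>Vieta's formulas: subtract the two equations and cancel
    \<open>a - e\<close>.\<close>
  have "(a - e) * (q2 * (a + e) - q1) = 0"
    using fixed by algebra
  then have sum: "q2 * (a + e) = q1"
    using distinct by simp
  have "q2 * (a * e) = a * (q2 * (a + e)) - q2 * a\<^sup>2"
    by (simp add: algebra_simps power2_eq_square)
  then have "q2 * (a * e) = - q0"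
    by (simp add: sum fixed(1) mult.commute)
  with sum \<open>q2 \<noteq> 0\<close> have "a + e = q1 / q2" "a * e = - q0 / q2"
    by (simp_all add: field_simps)
  then have sum_in: "a + e \<in> K" and prod_in: "a * e \<in> K"
    by (simp_all only: K_closed q_in)

  \<comment> \<open>The corresponding side of the other triangle serves as the second chord, which
    keeps the denominators nonzero.\<close>
  have b: "a * z0 - z1 \<noteq> 0" "b = (a * z1 - z2) / (a * z0 - z1)"
    using chord_partner[of a b z0 z1 z2 e f] z_on nz distinct unfolding c by blast+
  have f: "e * z0 - z1 \<noteq> 0" "f = (e * z1 - z2) / (e * z0 - z1)"
    using chord_partner[of e f z0 z1 z2 a b] z_on nz distinct unfolding c by blast+
  have c': "a * x0 - x1 \<noteq> 0" "c = (a * x1 - x2) / (a * x0 - x1)"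
    using chord_partner[of a c x0 x1 x2 e d] x_on nz distinct unfolding c by blast+
  have d: "e * x0 - x1 \<noteq> 0" "d = (e * x1 - x2) / (e * x0 - x1)"
    using chord_partner[of e d x0 x1 x2 a c] x_on nz distinct unfolding c by blast+

  text \<open>
    The conjugation exchanges \<open>a, b, c\<close> with \<open>e, f, d\<close>, hence \<open>P\<close> with \<open>P'\<close>, but it fixes the line
    \<open>\<langle>1, s4, t4\<rangle>\<close>.
  \<close>
  have "a \<in> K"
  proof (rule ccontr)
    assume "a \<notin> K"
    then interpret quadratic_pair K a e
      by unfold_locales (use K sum_in prod_in in simp_all)
    \<comment> \<open>The formulas for \<open>b\<close> and \<open>f\<close>, and for
      \<open>c\<close> and \<open>d\<close>, have the same coefficients from \<open>K\<close> and
      differ only in \<open>a\<close> and \<open>e\<close>.\<close>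
    have bf: "conj b f" and cd: "conj c d"
      unfolding b(2) f(2) c'(2) d(2)
      by (intro conj_divide conj_diff conj_mult conj_const conj_root c_in f(1) d(1))+
    \<comment> \<open>\<open>P\<close> involves vertices of both triangles, so the exchange is
      needed in both directions.\<close>
    have fb: "conj f b" and dc: "conj d c"
      unfolding b(2) f(2) c'(2) d(2)
      by (intro conj_divide conj_diff conj_mult conj_const conj_root' c_in b(1) c'(1))+
    have one: "conj 1 1"
      by (intro conj_const K_closed)
    have "conj (dot (1, s4, t4) P) (dot (1, s4, t4) P')"
      unfolding P_def P'_def chord_def cross.simps dot.simps
      by (intro conj_add conj_diff conj_uminus conj_mult bf fb cd dc conj_root conj_root' one
          conj_const in_K)
    then have "dot (1, s4, t4) P' = 0"
      using conj_eq_0 l4(1) by blast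
    then show False
      using triangle_not_on_line[OF PPQ l4(1) _ l4(2)] not_zvec by blast
  qed
  moreover from this have "e \<in> K"
    using K_closed(7)[OF sum_in] by fastforce
  moreover have "b \<in> K" "c \<in> K" "d \<in> K" "f \<in> K"
    unfolding b(2) f(2) c'(2) d(2) by (intro K_closed c_in \<open>a \<in> K\<close> \<open>e \<in> K\<close>)+
  ultimately show ?thesis
    by simp
qed


section \<open>Recovering the six points\<close>

theorem mainTheorem1:
  fixes a b c d e f :: ratfun6
    and A B C D E F :: "(ratfun6 \<times> ratfun6 \<times> ratfun6) set"
    and s1 t1 s2 t2 s3 t3 s_star t_star :: ratfun6
  assumes "a = indet 0" and "b = indet 1" and "c = indet 2"
    and "d = indet 3" and "e = indet 4" and "f = indet 5"
    and "A = hpoint 1 a (a^2)" and "B = hpoint 1 b (b^2)" and "C = hpoint 1 c (c^2)"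
    and "D = hpoint 1 d (d^2)" and "E = hpoint 1 e (e^2)" and "F = hpoint 1 f (f^2)"
    and "pascal_line A D B
                     E C F = hline 1 s1 t1"
    and "pascal_line A C F
                     E D B = hline 1 s2 t2"
    and "pascal_line A D F
                     E C B = hline 1 s3 t3"
    and "pascal_line A B C
                     F D E = hline 1 s_star t_star"
  shows "(\<forall>x\<in>{a, b, c, d, e, f}. is_rational_function_of x [s1, t1, s2, t2, s3, t3, s_star, t_star]) \<and>
    rat_adjoin {s1, t1, s2, t2, s3, t3, s_star, t_star} = (UNIV :: ratfun6 set)"
proof -
  \<comment> \<open>A sample point with distinct coordinates at which all polynomials tested below
    are nonzero.\<close>
  define v :: "6 \<Rightarrow> rat"
    where "v i = (if i = 1 then 1 else if i = 2 then 3 else if i = 3 then 2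
      else if i = 4 then - 4 else if i = 5 then - 1 else 0)" for i
  have spec: "specializes v a 0" "specializes v b 1" "specializes v c 3"
    "specializes v d 2" "specializes v e (- 4)" "specializes v f (- 1)"
    using specializes_indet[of v 0] specializes_indet[of v 1] specializes_indet[of v 2]
      specializes_indet[of v 3] specializes_indet[of v 4] specializes_indet[of v 5]
    by (simp_all add: assms(1-6) v_def)
  note spec_intros = spec specializes_add specializes_diff specializes_mult specializes_uminus
    specializes_1
  have distinct: "distinct [a, b, c, d, e, f]"
  proof -
    have ne: "x \<noteq> y" if "specializes v x r" "specializes v y s" "r \<noteq> s" for x y r s
      using specializes_nonzero[OF specializes_diff[OF that(1,2)]] that(3) by auto
    show ?thesis
      by (simp; intro conjI; rule ne, rule spec, rule spec, simp)
  qed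
  let ?X = "cross (chord a c) (chord d e)" and ?Y = "cross (chord d f) (chord b c)"
    and ?Z = "cross (chord a b) (chord f e)" and ?P = "cross (chord a d) (chord b f)"
    and ?P' = "cross (chord e c) (chord f b)" and ?Q = "cross (chord b e) (chord c d)"
  \<comment> \<open>One nonzero coordinate suffices: \<open>nz\<close> tests the first,
    \<open>nz3\<close> the third.\<close>
  have nz: "(x, y, z) \<noteq> zvec" if "specializes v x r" "r \<noteq> 0" for x y z r
    using specializes_nonzero[OF that] by (simp add: zvec_def)
  have nz3: "(x, y, z) \<noteq> zvec" if "specializes v z r" "r \<noteq> 0" for x y z r
    using specializes_nonzero[OF that] by (simp add: zvec_def)
  \<comment> \<open>For each of the four arrays, the first two Pascal points are distinct;
    \<open>meet_nz\<close> treats the third points, with \<open>?Z\<close> shared by the second and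
    third arrays.\<close>
  have cross_nz:
    "cross ?X ?Y \<noteq> zvec"
    "cross (cross (chord a d) (chord c e)) (cross (chord c b) (chord f d)) \<noteq> zvec"
    "cross ?X (cross (chord d b) (chord f c)) \<noteq> zvec"
    "cross ?P ?Q \<noteq> zvec"
    unfolding chord_def cross.simps by ((rule nz3, (rule spec_intros)+, simp)+)
  have meet_nz:
    "cross (chord a f) (chord b e) \<noteq> zvec" "?Z \<noteq> zvec"
    "cross (chord a e) (chord c f) \<noteq> zvec"
    unfolding chord_def cross.simps by ((rule nz, (rule spec_intros)+, simp)+)
  have l1: "dot (1, s1, t1) ?X = 0" "dot (1, s1, t1) ?Y = 0"
    by (rule pascal_line_incidence[OF _ _ _ _ _ _ cross_nz(1) meet_nz(1)
            assms(13)[unfolded assms(7-12)]];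
      use distinct in force)+
  have l2': "dot (1, s2, t2) (cross (chord c b) (chord f d)) = 0" and l2: "dot (1, s2, t2) ?Z = 0"
    by (rule pascal_line_incidence[OF _ _ _ _ _ _ cross_nz(2) meet_nz(2)
            assms(14)[unfolded assms(7-12)]];
      use distinct in force)+
  \<comment> \<open>The second array yields the point \<open>?Y\<close> with its two chords in the
    opposite order, hence with the opposite sign.\<close>
  have "dot (1, s2, t2) ?Y = - dot (1, s2, t2) (cross (chord c b) (chord f d))"
    by (simp add: chord_def algebra_simps)
  with l2' have l2': "dot (1, s2, t2) ?Y = 0"
    by simp
  have l3: "dot (1, s3, t3) ?X = 0" "dot (1, s3, t3) ?Z = 0"
    by (rule pascal_line_incidence[OF _ _ _ _ _ _ cross_nz(3) meet_nz(2)
            assms(15)[unfolded assms(7-12)]];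
      use distinct in force)+
  have l4: "dot (1, s_star, t_star) ?P = 0" "dot (1, s_star, t_star) ?Q = 0"
    by (rule pascal_line_incidence[OF _ _ _ _ _ _ cross_nz(4) meet_nz(3)
            assms(16)[unfolded assms(7-12)]];
      use distinct in force)+
  have generic: "dot (cross ?X ?Y) ?Z \<noteq> 0" "fix2 ?X ?Y ?Z \<noteq> 0" "dot (cross ?P ?P') ?Q \<noteq> 0"
    unfolding chord_def cross.simps dot.simps fix2.simps
    by ((rule specializes_nonzero, (rule spec_intros)+, simp)+)
  let ?S = "{s1, t1, s2, t2, s3, t3, s_star, t_star}"
  \<comment> \<open>Used twice: for each subfield in the intersection defining
    \<open>rat_adjoin\<close>, and for the subfield of rational functions of the eight
    coordinates.\<close>
  have in_K: "{a, b, c, d, e, f} \<subseteq> K" if "is_subfield K" "?S \<subseteq> K" for K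
    by (rule sextuple_in_subfield[OF that(1), of s1 t1 s2 t2 s3 t3 s_star t_star])
      (use that(2) distinct generic l1 l2 l2' l3 l4 in
        \<open>auto simp del: dot.simps cross.simps fix2.simps\<close>)
  have "rat_adjoin ?S = UNIV"
  proof -
    have "K = UNIV" if "is_subfield K" "?S \<subseteq> K" for K
    proof (rule subfield_generated_by_indets[OF that(1)])
      show "indet i \<in> K" for i
        using in_K[OF that] cases_6[of i] assms(1-6) by auto
    qed
    then show ?thesis
      unfolding rat_adjoin_def by blast
  qed
  moreover have "\<forall>x\<in>{a, b, c, d, e, f}.
      is_rational_function_of x [s1, t1, s2, t2, s3, t3, s_star, t_star]"
    using in_K[OF is_rational_function_of_subfield[of "[s1, t1, s2, t2, s3, t3, s_star, t_star]"]]
      is_rational_function_of_member[of _ "[s1, t1, s2, t2, s3, t3, s_star, t_star]"]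
    by auto
  ultimately show ?thesis
    by blast
qed

end
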